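(* For every integer $n\ge 2$, the path $P_{2n+1}$ on $2n+1$ vertices satisfies $\operatorname{adim}_2(P_{2n+1})=1$. For every integer $n\ge 3$, the cycle $C_n$ on $n$ vertices satisfies $$\operatorname{adim}_2(C_n)=\begin{cases}1, & \text{if } n \text{ is odd},\\ 2, & \text{if } n\text{ is even}.\end{cases}$$
   Context: Let $G=(V,E)$ be a finite simple connected graph and $d_G(u,v)$ the length of a shortest path between $u$ and $v$. For an ordered set $S=\{u_1,\dots,u_t\}\subseteq V$ ($t\ge1$) and $v\in V$, the metric representation of $v$ with respect to $S$ is $r(v|S)=(d_G(v,u_1),\dots,d_G(v,u_t))$. A nonempty proper subset $S\subset V$ is a $k$-antiresolving set if $k$ is the greatest positive integer such that for every $v\in V-S$ there exist at least $k-1$ different vertices $v_1,\dots,v_{k-1}\in V-S$, all different from $v$, with $r(v|S)=r(v_1|S)=\cdots=r(v_{k-1}|S)$. The $k$-metric antidimension $\operatorname{adim}_k(G)$ is the minimum cardinality amongst the $k$-antiresolving sets in $G$. *)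

theory Defs
  imports "Graph_Theory.Graph_Theory"
begin

text \<open>
  A finite simple graph is a \<^locale>\<open>pair_graph\<close>: a finite, loop-free, symmetric digraph
  without parallel arcs. The notions below are intended for connected such graphs.
\<close>

definition graph_dist :: "'a pair_pre_digraph \<Rightarrow> 'a \<Rightarrow> 'a \<Rightarrow> nat" where
  "graph_dist G u v = (LEAST l. \<exists>p. pre_digraph.apath (with_proj G) u p v \<and> length p = l)"

definition metric_repr :: "'a pair_pre_digraph \<Rightarrow> 'a list \<Rightarrow> 'a \<Rightarrow> nat list" where
  "metric_repr G us v = map (graph_dist G v) us"

definition antiresolving_property :: "'a pair_pre_digraph \<Rightarrow> 'a list \<Rightarrow> nat \<Rightarrow> bool" where
  "antiresolving_property G us k \<longleftrightarrow>
     (\<forall>v \<in> pverts G - set us.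
        \<exists>W \<subseteq> pverts G - set us - {v}.
          finite W \<and> k - 1 \<le> card W \<and> (\<forall>w \<in> W. metric_repr G us v = metric_repr G us w))"

text \<open>
  The list \<open>us\<close> is an ordering of \<open>S\<close>; by \<open>antiresolving_property_cong\<close> below the choice of
  ordering is immaterial.
\<close>

definition k_antiresolving_set :: "'a pair_pre_digraph \<Rightarrow> nat \<Rightarrow> 'a set \<Rightarrow> bool" where
  "k_antiresolving_set G k S \<longleftrightarrow>
     S \<noteq> {} \<and> S \<subset> pverts G \<and>
     (\<exists>us. distinct us \<and> set us = S \<and>
        k \<ge> 1 \<and> antiresolving_property G us k \<and>
        (\<forall>j \<ge> 1. antiresolving_property G us j \<longrightarrow> j \<le> k))"

text \<open>
  If \<open>G\<close> has no \<open>k\<close>-antiresolving set, the value of \<open>adim k G\<close> is unspecified.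
\<close>

definition adim :: "nat \<Rightarrow> 'a pair_pre_digraph \<Rightarrow> nat" where
  "adim k G = (LEAST m. \<exists>S. k_antiresolving_set G k S \<and> card S = m)"

definition path_graph :: "nat \<Rightarrow> nat pair_pre_digraph" where
  "path_graph n =
     \<lparr> pverts = {0..<n},
       parcs = {(i, j). i < n \<and> j < n \<and> (j = Suc i \<or> i = Suc j)} \<rparr>"

text \<open>
  \<open>cycle_graph n\<close> is the cycle on \<open>n\<close> vertices only for \<open>n \<ge> 3\<close>.
\<close>

definition cycle_graph :: "nat \<Rightarrow> nat pair_pre_digraph" where
  "cycle_graph n =
     \<lparr> pverts = {0..<n},
       parcs = {(i, j). i < n \<and> j < n \<and> (j = Suc i mod n \<or> i = Suc j mod n)} \<rparr>"

lemma metric_repr_eq_iff: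
  "metric_repr G us v = metric_repr G us w \<longleftrightarrow>
     (\<forall>u \<in> set us. graph_dist G v u = graph_dist G w u)"
  by (simp add: metric_repr_def)

lemma antiresolving_property_cong:
  "set us = set vs \<Longrightarrow> antiresolving_property G us k \<longleftrightarrow> antiresolving_property G vs k"
  by (simp add: antiresolving_property_def metric_repr_eq_iff)

lemma pair_graph_path_graph: "pair_graph (path_graph n)"
proof
  show "finite (parcs (path_graph n))"
    by (rule finite_subset[of _ "{0..<n} \<times> {0..<n}"]) (auto simp: path_graph_def)
qed (auto simp: path_graph_def symmetric_def sym_def)

lemma pair_graph_cycle_graph:
  assumes "n \<ge> 3"
  shows "pair_graph (cycle_graph n)"
proof
  show "finite (parcs (cycle_graph n))"
    by (rule finite_subset[of _ "{0..<n} \<times> {0..<n}"]) (auto simp: cycle_graph_def)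
qed (use assms in \<open>auto simp: cycle_graph_def symmetric_def sym_def mod_Suc split: if_splits\<close>)

lemma connected_if_succ_arcs:
  assumes G: "pair_graph G" and V: "pverts G = {0..<n}" and n: "n \<ge> 1"
    and arcs: "\<And>i. Suc i < n \<Longrightarrow> (i, Suc i) \<in> parcs G"
  shows "connected (with_proj G)"
proof -
  interpret pair_graph G by fact
  have from0: "0 \<rightarrow>\<^sup>*\<^bsub>with_proj G\<^esub> i" if "i < n" for i
    using that
  proof (induction i)
    case 0
    then show ?case using V by (intro reachable_refl) simp
  next
    case (Suc i)
    then show ?case
      using arcs[of i] reachable_adj_trans[of 0 i "Suc i"] by simp
  qed
  have "strongly_connected (with_proj G)"
  proof (rule strongly_connectedI)
    show "verts (with_proj G) \<noteq> {}" using V n by simp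
    fix u v assume "u \<in> verts (with_proj G)" "v \<in> verts (with_proj G)"
    then have "0 \<rightarrow>\<^sup>*\<^bsub>with_proj G\<^esub> u" "0 \<rightarrow>\<^sup>*\<^bsub>with_proj G\<^esub> v" using from0 V by auto
    moreover from this have "u \<rightarrow>\<^sup>*\<^bsub>with_proj G\<^esub> 0" using symmetric_reachable[OF sym_arcs] by blast
    ultimately show "u \<rightarrow>\<^sup>*\<^bsub>with_proj G\<^esub> v" using reachable_trans by blast
  qed
  moreover have "mk_symmetric (with_proj G) = G"
    using sym_arcs by (cases G) (auto simp: mk_symmetric_def symmetric_def sym_def with_proj_def arcs_ends_def arc_to_ends_def)
  ultimately show ?thesis by (simp add: connected_def)
qed

lemma connected_path_graph: "n \<ge> 1 \<Longrightarrow> connected (with_proj (path_graph n))"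
  by (rule connected_if_succ_arcs[OF pair_graph_path_graph]) (auto simp: path_graph_def)

lemma connected_cycle_graph: "n \<ge> 3 \<Longrightarrow> connected (with_proj (cycle_graph n))"
  by (rule connected_if_succ_arcs[OF pair_graph_cycle_graph]) (auto simp: cycle_graph_def)

end

theory Submission
  imports Defs
begin

text \<open>
  The distance to a fixed vertex is the only potential that vanishes exactly there, changes by at
  most one along every arc and can be decreased by one at every other vertex; this yields the
  distances in paths and cycles. Take as antiresolving set the midpoint of an odd path, one vertex of
  an odd cycle or two antipodal vertices of an even cycle. The reflection fixing it has no other
  fixed points, and its orbits outside the set are exactly the classes of equal representation. In
  an even cycle a single vertex does not suffice, because its antipode has no partner.
\<close>

section \<open>Distances from potentials\<close>

context pair_graph
begin

text \<open>Each arc lowers \<open>f\<close> by at most one, so a walk ending where \<open>f\<close>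
  vanishes needs at least \<open>f x\<close> arcs. This is the lower bound on the distance.\<close>

lemma potential_le_awalk_length:
  assumes "awalk x p y" "f y = (0::nat)"
    and "\<And>u v. (u, v) \<in> parcs G \<Longrightarrow> f u \<le> Suc (f v)"
  shows "f x \<le> length p"
  using assms(1)
proof (induction p arbitrary: x)
  case Nil
  then show ?case using assms(2) by (simp add: awalk_Nil_iff)
next
  case (Cons e p)
  obtain a b where e: "e = (a, b)" by (cases e)
  with Cons.prems have "x = a" "(a, b) \<in> parcs G" "awalk b p y"
    by (auto simp: awalk_Cons_iff)
  with Cons.IH[of b] assms(3)[of a b] show ?case by simp
qed

text \<open>Greedy descent from \<open>x\<close> reaches \<open>y\<close> after \<open>f x\<close>
  arcs, which gives the upper bound on the distance. The bound on \<open>f\<close> along the path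
  strengthens the induction: a vertex put in front has a larger value than all later ones, so no
  vertex repeats.\<close>

lemma apath_along_potential:
  assumes "x \<in> pverts G" "y \<in> pverts G"
    and "\<And>u. u \<in> pverts G \<Longrightarrow> f u = (0::nat) \<Longrightarrow> u = y"
    and "\<And>u. u \<in> pverts G \<Longrightarrow> f u > 0 \<Longrightarrow> \<exists>v. (u, v) \<in> parcs G \<and> f u = Suc (f v)"
  shows "\<exists>p. apath x p y \<and> length p = f x \<and> (\<forall>z\<in>set (awalk_verts x p). f z \<le> f x)"
  using assms(1)
proof (induction "f x" arbitrary: x)
  case 0
  then have "x = y" using assms(3) by simp
  then show ?case using 0 by (intro exI[of _ "[]"]) (auto simp: apath_Nil_iff)
next
  case (Suc n)
  obtain v where v: "(x, v) \<in> parcs G" "f x = Suc (f v)"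
    using assms(4)[of x] Suc by auto
  then have "v \<in> pverts G" using in_arcsD2 by auto
  with Suc v obtain p where p: "apath v p y" "length p = f v"
    "\<forall>z\<in>set (awalk_verts v p). f z \<le> f v" by fastforce
  from p v have "apath x ((x, v) # p) y"
    by (force simp: apath_Cons_iff)
  with p v show ?case by (intro exI[of _ "(x, v) # p"]) auto
qed

lemma graph_dist_eqI:
  assumes "x \<in> pverts G" "y \<in> pverts G" "f y = (0::nat)"
    and "\<And>u. u \<in> pverts G \<Longrightarrow> f u = 0 \<Longrightarrow> u = y"
    and "\<And>u v. (u, v) \<in> parcs G \<Longrightarrow> f u \<le> Suc (f v)"
    and "\<And>u. u \<in> pverts G \<Longrightarrow> f u > 0 \<Longrightarrow> \<exists>v. (u, v) \<in> parcs G \<and> f u = Suc (f v)"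
  shows "graph_dist G x y = f x"
  unfolding graph_dist_def
proof (rule Least_equality)
  show "\<exists>p. apath x p y \<and> length p = f x"
    using apath_along_potential[of x y f] assms by blast
  show "f x \<le> l" if "\<exists>p. apath x p y \<and> length p = l" for l
    using that potential_le_awalk_length[where f = f, OF _ assms(3,5)] unfolding apath_def by blast
qed

end

section \<open>Distances in paths\<close>

lemma pverts_path_graph [simp]: "pverts (path_graph n) = {0..<n}"
  by (simp add: path_graph_def)

text \<open>With truncated subtraction the sum is the absolute difference of \<open>x\<close> and
  \<open>c\<close>; a step towards \<open>c\<close> lowers it by one.\<close>

lemma graph_dist_path_graph:
  assumes "x < n" "c < n"
  shows "graph_dist (path_graph n) x c = (x - c) + (c - x)"
proof -
  interpret pair_graph "path_graph n" by (rule pair_graph_path_graph)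
  show ?thesis
  proof (rule graph_dist_eqI[where f = "\<lambda>x. (x - c) + (c - x)"])
    fix u assume "u \<in> pverts (path_graph n)" "u - c + (c - u) > 0"
    then show "\<exists>v. (u, v) \<in> parcs (path_graph n) \<and> u - c + (c - u) = Suc (v - c + (c - v))"
      using assms
      by (intro exI[of _ "if u < c then Suc u else u - 1"]) (auto simp: path_graph_def)
  qed (use assms in \<open>auto simp: path_graph_def\<close>)
qed

section \<open>Distances in cycles\<close>

lemma pverts_cycle_graph [simp]: "pverts (cycle_graph n) = {0..<n}"
  by (simp add: cycle_graph_def)

text \<open>For \<open>x\<close> and \<open>c\<close> below \<open>n\<close> this is the residue of
  \<open>x - c\<close> modulo \<open>n\<close>, the number of successor steps from \<open>c\<close>
  to \<open>x\<close>. The case distinction keeps it within linear arithmetic.\<close>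

definition cycle_offset :: "nat \<Rightarrow> nat \<Rightarrow> nat \<Rightarrow> nat" where
  "cycle_offset n c x = (if c \<le> x then x - c else x + n - c)"

definition cycle_dist :: "nat \<Rightarrow> nat \<Rightarrow> nat \<Rightarrow> nat" where
  "cycle_dist n c x = min (cycle_offset n c x) (n - cycle_offset n c x)"

lemma cycle_offset_less: "x < n \<Longrightarrow> c < n \<Longrightarrow> cycle_offset n c x < n"
  by (auto simp: cycle_offset_def)

lemma cycle_offset_inject:
  "x < n \<Longrightarrow> y < n \<Longrightarrow> c < n \<Longrightarrow> cycle_offset n c x = cycle_offset n c y \<longleftrightarrow> x = y"
  by (auto simp: cycle_offset_def split: if_splits)

lemma cycle_offset_Suc_mod:
  "x < n \<Longrightarrow> c < n \<Longrightarrow> cycle_offset n c (Suc x mod n) = Suc (cycle_offset n c x) mod n"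
  by (auto simp: cycle_offset_def mod_Suc)

text \<open>Going once around from \<open>c\<close>, the distance rises on the first half and falls
  on the second. The middle case is the one arc opposite \<open>c\<close> in an odd cycle, whose
  ends are equally far from \<open>c\<close>.\<close>

lemma cycle_dist_Suc_mod:
  assumes "x < n" "c < n"
  shows "cycle_dist n c (Suc x mod n) =
    (if 2 * cycle_offset n c x < n - 1 then Suc (cycle_dist n c x)
     else if 2 * cycle_offset n c x = n - 1 then cycle_dist n c x
     else cycle_dist n c x - 1)"
  using cycle_offset_less[OF assms]
  unfolding cycle_dist_def cycle_offset_Suc_mod[OF assms]
  by (cases "Suc (cycle_offset n c x) = n") auto

lemma graph_dist_cycle_graph:
  assumes "n \<ge> 3" "x < n" "c < n"
  shows "graph_dist (cycle_graph n) x c = cycle_dist n c x"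
proof -
  interpret pair_graph "cycle_graph n" by (rule pair_graph_cycle_graph) fact
  have arc: "(u, v) \<in> parcs (cycle_graph n) \<longleftrightarrow>
      u < n \<and> v < n \<and> (v = Suc u mod n \<or> u = Suc v mod n)" for u v
    by (simp add: cycle_graph_def)
  show ?thesis
  proof (rule graph_dist_eqI[where f = "cycle_dist n c"])
    show "cycle_dist n c c = 0" by (simp add: cycle_dist_def cycle_offset_def)
  next
    fix u assume "u \<in> pverts (cycle_graph n)" and z: "cycle_dist n c u = 0"
    then have "u < n" by simp
    with z cycle_offset_less[of u n c] assms have "cycle_offset n c u = cycle_offset n c c"
      by (auto simp: cycle_dist_def cycle_offset_def[of n c c] min_def split: if_splits)
    then show "u = c" using cycle_offset_inject \<open>u < n\<close> assms by blast
  next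
    fix u assume "u \<in> pverts (cycle_graph n)" and pos: "cycle_dist n c u > 0"
    then have u: "u < n" by simp
    \<comment> \<open>The vertex \<open>p\<close> precedes \<open>u\<close> on the cycle. The
      neighbour nearer to \<open>c\<close> is \<open>p\<close> if the arc from \<open>p\<close> to
      \<open>u\<close> is on the rising half, and the successor of \<open>u\<close>
      otherwise.\<close>
    define p where "p = (if u = 0 then n - 1 else u - 1)"
    have p: "p < n" "u = Suc p mod n" using u by (auto simp: p_def)
    define k where "k = cycle_offset n c p"
    have k: "k < n" using cycle_offset_less p assms by (simp add: k_def)
    have ku: "cycle_offset n c u = Suc k mod n"
      using cycle_offset_Suc_mod[of p n c] p assms by (simp add: k_def)
    show "\<exists>v. (u, v) \<in> parcs (cycle_graph n) \<and> cycle_dist n c u = Suc (cycle_dist n c v)"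
    proof (cases "2 * k < n - 1")
      case True
      then have "cycle_dist n c u = Suc (cycle_dist n c p)"
        using cycle_dist_Suc_mod[of p n c] p assms by (simp add: k_def)
      then show ?thesis using p u by (intro exI[of _ p]) (simp add: arc)
    next
      case False
      \<comment> \<open>Wrapping around would give \<open>u\<close> offset zero, hence distance
        zero.\<close>
      have "Suc k \<noteq> n" using pos ku by (auto simp: cycle_dist_def)
      then have "cycle_offset n c u = Suc k" using ku k by simp
      then have "cycle_dist n c (Suc u mod n) = cycle_dist n c u - 1"
        using cycle_dist_Suc_mod[of u n c] False u assms by auto
      then show ?thesis using pos u by (intro exI[of _ "Suc u mod n"]) (simp add: arc)
    qed
  next
    fix u v assume "(u, v) \<in> parcs (cycle_graph n)"
    \<comment> \<open>The arc may run in either direction around the cycle, so the successor formula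
      is needed at both ends.\<close>
    then show "cycle_dist n c u \<le> Suc (cycle_dist n c v)"
      using cycle_dist_Suc_mod[of u n c] cycle_dist_Suc_mod[of v n c] assms(3)
      by (auto simp: arc split: if_splits)
  qed (use assms in auto)
qed

section \<open>Criteria for 2-antiresolving sets\<close>

text \<open>Outside \<open>S\<close> the class of \<open>v\<close> is exactly \<open>v\<close> and
  its twin \<open>\<sigma> v\<close>. The twin provides the one further vertex required for 2, and
  any vertex outside the proper subset \<open>S\<close> rules out larger values.\<close>

lemma two_antiresolving_setI:
  assumes "finite S" "S \<noteq> {}" "S \<subset> pverts G"
    and twin: "\<And>v. v \<in> pverts G - S \<Longrightarrow> \<sigma> v \<in> pverts G - S - {v}"
    and same: "\<And>v w. v \<in> pverts G - S \<Longrightarrow> w \<in> pverts G - S - {v} \<Longrightarrow>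
      (\<forall>u\<in>S. graph_dist G v u = graph_dist G w u) \<longleftrightarrow> w = \<sigma> v"
  shows "k_antiresolving_set G 2 S"
proof -
  obtain us where us: "distinct us" "set us = S"
    using finite_distinct_list[OF \<open>finite S\<close>] by blast
  have "antiresolving_property G us 2"
    unfolding antiresolving_property_def metric_repr_eq_iff us
  proof
    fix v assume v: "v \<in> pverts G - S"
    have "\<forall>u\<in>S. graph_dist G v u = graph_dist G (\<sigma> v) u"
      using same[OF v twin[OF v]] by blast
    with twin[OF v] show "\<exists>W\<subseteq>pverts G - S - {v}. finite W \<and> 2 - 1 \<le> card W \<and>
        (\<forall>w\<in>W. \<forall>u\<in>S. graph_dist G v u = graph_dist G w u)"
      by (intro exI[of _ "{\<sigma> v}"]) simp
  qed
  moreover have "j \<le> 2" if j: "antiresolving_property G us j" for j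
  proof -
    obtain v where v: "v \<in> pverts G - S" using \<open>S \<subset> pverts G\<close> by blast
    obtain W where W: "W \<subseteq> pverts G - S - {v}" "j - 1 \<le> card W"
      "\<forall>w\<in>W. \<forall>u\<in>S. graph_dist G v u = graph_dist G w u"
      using j[unfolded antiresolving_property_def metric_repr_eq_iff us, rule_format, OF v]
      by blast
    then have "W \<subseteq> {\<sigma> v}" using same[OF v] by blast
    then have "card W \<le> 1" using card_mono[of "{\<sigma> v}" W] by simp
    with W show ?thesis by simp
  qed
  ultimately show ?thesis
    using assms(2,3) us unfolding k_antiresolving_set_def
    by (intro conjI exI[of _ us]) auto
qed

text \<open>Used for the lower bound in even cycles: a vertex outside \<open>S\<close> without a
  twin refutes the property.\<close>

lemma k_antiresolving_set_ex_twin: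
  assumes "k_antiresolving_set G 2 S" "v \<in> pverts G - S"
  shows "\<exists>w \<in> pverts G - S - {v}. \<forall>u\<in>S. graph_dist G v u = graph_dist G w u"
proof -
  obtain us where us: "set us = S" and anti: "antiresolving_property G us 2"
    using assms(1) unfolding k_antiresolving_set_def by blast
  obtain W where W: "W \<subseteq> pverts G - S - {v}" "2 - 1 \<le> card W"
    "\<forall>w\<in>W. \<forall>u\<in>S. graph_dist G v u = graph_dist G w u"
    using anti[unfolded antiresolving_property_def metric_repr_eq_iff us, rule_format, OF assms(2)]
    by blast
  then have "W \<noteq> {}" by auto
  with W show ?thesis by blast
qed

lemma adim_eqI:
  assumes "k_antiresolving_set G k S" "card S = m"
    and "\<And>T. k_antiresolving_set G k T \<Longrightarrow> m \<le> card T"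
  shows "adim k G = m"
  unfolding adim_def by (rule Least_equality) (use assms in auto)

lemma k_antiresolving_set_card_pos:
  assumes "k_antiresolving_set G k S"
  shows "1 \<le> card S"
proof -
  obtain us where "set us = S" using assms unfolding k_antiresolving_set_def by blast
  then have "finite S" by auto
  with assms show ?thesis by (simp add: k_antiresolving_set_def Suc_le_eq card_gt_0_iff)
qed

section \<open>Values for odd paths and for cycles\<close>

lemma adim_two_path_graph_odd:
  assumes "n \<ge> 1"
  shows "adim 2 (path_graph (2 * n + 1)) = 1"
proof (rule adim_eqI)
  show "k_antiresolving_set (path_graph (2 * n + 1)) 2 {n}"
  proof (rule two_antiresolving_setI[where \<sigma> = "\<lambda>v. 2 * n - v"])
    have "0 \<in> pverts (path_graph (2 * n + 1)) - {n}" "n \<in> pverts (path_graph (2 * n + 1))"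
      using assms by simp_all
    then show "{n} \<subset> pverts (path_graph (2 * n + 1))" by blast
  next
    fix v w assume "v \<in> pverts (path_graph (2 * n + 1)) - {n}"
      "w \<in> pverts (path_graph (2 * n + 1)) - {n} - {v}"
    then show "(\<forall>u\<in>{n}. graph_dist (path_graph (2 * n + 1)) v u =
        graph_dist (path_graph (2 * n + 1)) w u) \<longleftrightarrow> w = 2 * n - v"
      by (auto simp: graph_dist_path_graph)
  qed auto
qed (simp, rule k_antiresolving_set_card_pos)

lemma adim_two_cycle_graph_odd:
  assumes "odd n" "n \<ge> 3"
  shows "adim 2 (cycle_graph n) = 1"
proof (rule adim_eqI)
  show "k_antiresolving_set (cycle_graph n) 2 {0}"
  proof (rule two_antiresolving_setI[where \<sigma> = "\<lambda>v. n - v"])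
    show "{0} \<subset> pverts (cycle_graph n)"
      using assms psubsetI[of "{0}" "{0..<n}"] by (force simp: set_eq_iff)
  next
    fix v assume "v \<in> pverts (cycle_graph n) - {0}"
    then show "n - v \<in> pverts (cycle_graph n) - {0} - {v}"
      \<comment> \<open>Parity excludes \<open>n - v = v\<close>.\<close>
      using \<open>odd n\<close> by (auto; presburger)
  next
    fix v w assume "v \<in> pverts (cycle_graph n) - {0}" "w \<in> pverts (cycle_graph n) - {0} - {v}"
    then show "(\<forall>u\<in>{0}. graph_dist (cycle_graph n) v u = graph_dist (cycle_graph n) w u)
        \<longleftrightarrow> w = n - v"
      using assms by (auto simp: graph_dist_cycle_graph cycle_dist_def cycle_offset_def)
  qed auto
qed (simp, rule k_antiresolving_set_card_pos)

lemma adim_two_cycle_graph_even: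
  assumes "m \<ge> 2"
  shows "adim 2 (cycle_graph (2 * m)) = 2"
proof (rule adim_eqI)
  show "k_antiresolving_set (cycle_graph (2 * m)) 2 {0, m}"
  \<comment> \<open>Modulo \<open>2 * m\<close> the reflection fixes exactly \<open>0\<close> and
    \<open>m\<close>. The distance to \<open>0\<close> already separates the orbits;
    \<open>m\<close> is put into the set because it has no twin.\<close>
  proof (rule two_antiresolving_setI[where \<sigma> = "\<lambda>v. 2 * m - v"])
    have "1 \<in> pverts (cycle_graph (2 * m)) - {0, m}" using assms by simp
    moreover have "{0, m} \<subseteq> pverts (cycle_graph (2 * m))" using assms by simp
    ultimately show "{0, m} \<subset> pverts (cycle_graph (2 * m))" by blast
  next
    fix v w
    assume "v \<in> pverts (cycle_graph (2 * m)) - {0, m}"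
      "w \<in> pverts (cycle_graph (2 * m)) - {0, m} - {v}"
    then show "(\<forall>u\<in>{0, m}. graph_dist (cycle_graph (2 * m)) v u =
        graph_dist (cycle_graph (2 * m)) w u) \<longleftrightarrow> w = 2 * m - v"
      using assms by (auto simp: graph_dist_cycle_graph cycle_dist_def cycle_offset_def)
  qed auto
next
  show "card {0, m} = 2" using assms by simp
next
  fix T assume T: "k_antiresolving_set (cycle_graph (2 * m)) 2 T"
  show "2 \<le> card T"
  proof (rule ccontr)
    assume "\<not> 2 \<le> card T"
    with k_antiresolving_set_card_pos[OF T] have "card T = 1" by simp
    then obtain u where u: "T = {u}" by (auto simp: card_1_singleton_iff)
    then have "u < 2 * m" using T by (auto simp: k_antiresolving_set_def)
    \<comment> \<open>The antipode of \<open>u\<close>.\<close>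
    define v where "v = (if u < m then u + m else u - m)"
    have v: "v < 2 * m" "v \<noteq> u" using assms \<open>u < 2 * m\<close> by (auto simp: v_def)
    then have "v \<in> pverts (cycle_graph (2 * m)) - T" using u by simp
    from k_antiresolving_set_ex_twin[OF T this]
    obtain w where "w \<in> pverts (cycle_graph (2 * m)) - T - {v}"
      and dist: "\<forall>x\<in>T. graph_dist (cycle_graph (2 * m)) v x = graph_dist (cycle_graph (2 * m)) w x"
      by blast
    then have w: "w < 2 * m" "w \<noteq> v" by auto
    with dist u have "cycle_dist (2 * m) u v = cycle_dist (2 * m) u w"
      using assms v \<open>u < 2 * m\<close> by (simp add: graph_dist_cycle_graph)
    moreover have "cycle_offset (2 * m) u v = m"
      using \<open>u < 2 * m\<close> by (auto simp: v_def cycle_offset_def)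
    \<comment> \<open>The minimum of \<open>k\<close> and \<open>2 * m - k\<close> equals
      \<open>m\<close> only at \<open>k = m\<close>, so the antipode is the only vertex at distance
      \<open>m\<close>.\<close>
    ultimately have "cycle_offset (2 * m) u w = cycle_offset (2 * m) u v"
      using assms by (auto simp: cycle_dist_def min_def split: if_splits)
    then show False using cycle_offset_inject w v \<open>u < 2 * m\<close> by blast
  qed
qed

theorem proposition14:
  shows "(\<forall>n::nat. n \<ge> 2 \<longrightarrow> adim 2 (path_graph (2 * n + 1)) = 1) \<and>
         (\<forall>n::nat. n \<ge> 3 \<longrightarrow> adim 2 (cycle_graph n) = (if odd n then 1 else 2))"
proof (intro conjI allI impI)
  fix n :: nat assume "n \<ge> 2"
  then show "adim 2 (path_graph (2 * n + 1)) = 1" by (intro adim_two_path_graph_odd) simp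
next
  fix n :: nat assume "n \<ge> 3"
  then show "adim 2 (cycle_graph n) = (if odd n then 1 else 2)"
    \<comment> \<open>For even \<open>n = 2 * m\<close>, the bound \<open>n \<ge> 3\<close> forces
      \<open>m \<ge> 2\<close>.\<close>
    using adim_two_cycle_graph_odd adim_two_cycle_graph_even by (auto elim!: evenE)
qed

end
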